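(* For every integer $d \geq 1$, the $\left(\lfloor \tfrac{d}{2} \rfloor + 1\right) \times d$ matrix $M_d = (m_{ij})$ with entries \[ m_{ij} = \binom{d+1-i}{d-j} - \binom{i}{d-j}, \qquad i = 0, \ldots, \lfloor \tfrac{d}{2} \rfloor, \quad j = 0, \ldots, d-1, \] is totally nonnegative.
   Context: A real matrix is called totally nonnegative if every minor of it is nonnegative, i.e. for every $k \geq 1$, every choice of $k$ rows $i_1 < \cdots < i_k$ and $k$ columns $j_1 < \cdots < j_k$, the determinant of the corresponding $k \times k$ submatrix (rows and columns kept in increasing order) is $\geq 0$. Binomial coefficients $\binom{a}{b}$ with integers $a, b \geq 0$ are the usual ones, with $\binom{a}{b} = 0$ if $b > a$. Rows of $M_d$ are indexed by $i$ and columns by $j$, in increasing order. *)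

theory Defs
  imports Complex_Main "Jordan_Normal_Form.Determinant" "Jordan_Normal_Form.DL_Submatrix"
begin

(* \<open>submatrix A I J\<close> lists the selected rows and columns in increasing order; the
   subset conditions make it a square matrix of order \<open>card I = card J\<close>. *)
definition totally_nonnegative :: "real mat \<Rightarrow> bool" where
  "totally_nonnegative A \<longleftrightarrow>
     (\<forall>k\<ge>1. \<forall>I J. I \<subseteq> {..<dim_row A} \<longrightarrow> J \<subseteq> {..<dim_col A} \<longrightarrow>
        card I = k \<longrightarrow> card J = k \<longrightarrow> det (submatrix A I J) \<ge> 0)"

(* Indices start at 0. In the given range \<open>i \<le> d div 2\<close> and \<open>j < d\<close>, so the subtractions
   on naturals never truncate; the difference of binomials is taken in the reals. *)
definition M :: "nat \<Rightarrow> real mat" where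
  "M d = mat (d div 2 + 1) d
     (\<lambda>(i, j). real ((d + 1 - i) choose (d - j)) - real (i choose (d - j)))"

end

(* Put X = x and S = 1 + x. Row i of M_d lists the coefficients of S^(d+1-i) - S^i by decreasing
   degree, so reverse both orders and write r = n - i with n = d div 2. With z = X^2 / S, the reversed
   rows are X (X + 2) S^n h_r for d = 2n+1 and X S^n (h_r + h_(r-1)) for d = 2n, where
   h_r = sum_k C(r+k+1, 2k+1) z^k.
   With g_r = sum_k C(r+k, 2k) z^k one has h_r = g_0 + ... + g_r and g_r = 1 + z (h_0 + ... + h_(r-1)),
   so the rows S^n h_r arise from the rows S^n z^k = X^(2k) S^(n-k) by repeatedly adding a row to the
   next one. The rows X^(2k) S^(n-k) arise in turn from the monomials X^(2k) by adding columns to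
   adjacent ones. Both kinds of operation preserve total nonnegativity. *)
theory Submission
  imports Defs
begin

section \<open>Minors of infinite arrays\<close>

text \<open>Index maps in place of index sets admit repeated and shifted indices, and an array
  without bounds needs no range conditions.\<close>

definition minor :: "(nat \<Rightarrow> nat \<Rightarrow> real) \<Rightarrow> nat \<Rightarrow> (nat \<Rightarrow> nat) \<Rightarrow> (nat \<Rightarrow> nat) \<Rightarrow> real" where
  "minor f k I J = det (mat k k (\<lambda>(a, b). f (I a) (J b)))"

(* Weakly increasing index sequences only add minors with repeated lines, which vanish. *)
definition tn :: "(nat \<Rightarrow> nat \<Rightarrow> real) \<Rightarrow> bool" where
  "tn f \<longleftrightarrow> (\<forall>k I J. mono_on {..<k} I \<longrightarrow> mono_on {..<k} J \<longrightarrow> 0 \<le> minor f k I J)"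

lemma minor_cong:
  assumes "\<And>a b. a < k \<Longrightarrow> b < k \<Longrightarrow> f (I a) (J b) = g (I' a) (J' b)"
  shows "minor f k I J = minor g k I' J'"
  unfolding minor_def by (rule arg_cong[where f = det], rule eq_matI) (use assms in auto)

lemma minor_transpose: "minor (\<lambda>i j. f j i) k J I = minor f k I J"
proof -
  let ?A = "mat k k (\<lambda>(a, b). f (I a) (J b))"
  have "mat k k (\<lambda>(a, b). f (I b) (J a)) = transpose_mat ?A"
    by (rule eq_matI) auto
  then show ?thesis
    using det_transpose[of ?A k] by (simp add: minor_def)
qed

lemma tn_transpose:
  assumes "tn f"
  shows "tn (\<lambda>i j. f j i)"
  using assms unfolding tn_def minor_transpose[of f] by blast

lemma minor_equal_rows:
  assumes "a < k" "b < k" "a \<noteq> b" "\<And>j. f (I a) j = f (I b) j"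
  shows "minor f k I J = 0"
  unfolding minor_def
proof (rule det_identical_rows[of _ k a b])
  show "row (mat k k (\<lambda>(a, b). f (I a) (J b))) a = row (mat k k (\<lambda>(a, b). f (I a) (J b))) b"
    using assms by (intro eq_vecI) auto
qed (use assms in auto)

lemma minor_zero_row:
  assumes "m < k" "\<And>b. b < k \<Longrightarrow> f (I m) (J b) = 0"
  shows "minor f k I J = 0"
proof -
  let ?A = "mat k k (\<lambda>(a, b). f (I a) (J b))"
  have "minor f k I J = (\<Sum>j<k. ?A $$ (m, j) * cofactor ?A m j)"
    unfolding minor_def by (rule laplace_expansion_row) (use assms in auto)
  also have "\<dots> = 0"
    by (rule sum.neutral) (use assms in auto)
  finally show ?thesis .
qed

section \<open>Operations preserving total nonnegativity\<close>

text \<open>The cofactors along row \<open>m\<close> do not involve row \<open>m\<close>, so the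
  Laplace expansion along it is linear in that row.\<close>

lemma det_row_combination:
  fixes u v :: "nat \<Rightarrow> real"
  assumes m: "m < k"
  shows "det (mat k k (\<lambda>(a, b). if a = m then \<alpha> * u b + \<beta> * v b else w a b)) =
    \<alpha> * det (mat k k (\<lambda>(a, b). if a = m then u b else w a b)) +
    \<beta> * det (mat k k (\<lambda>(a, b). if a = m then v b else w a b))"
proof -
  define A where "A z = mat k k (\<lambda>(a, b). if a = m then z b else w a b)" for z :: "nat \<Rightarrow> real"
  have del: "mat_delete (A z) m j = mat_delete (A z') m j" if "j < k" for z z' j
    unfolding mat_delete_def A_def by (rule eq_matI) (use that m in auto)
  have cof: "cofactor (A z) m j = cofactor (A u) m j" if "j < k" for z j
    unfolding cofactor_def using del[OF that, of z u] by simp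
  have expand: "det (A z) = (\<Sum>j<k. z j * cofactor (A u) m j)" for z
  proof -
    have "det (A z) = (\<Sum>j<k. A z $$ (m, j) * cofactor (A z) m j)"
      by (rule laplace_expansion_row) (use m in \<open>auto simp: A_def\<close>)
    also have "\<dots> = (\<Sum>j<k. z j * cofactor (A u) m j)"
      by (intro sum.cong refl, subst cof) (use m in \<open>auto simp: A_def\<close>)
    finally show ?thesis .
  qed
  have "det (A (\<lambda>b. \<alpha> * u b + \<beta> * v b)) = \<alpha> * det (A u) + \<beta> * det (A v)"
    unfolding expand by (simp add: sum.distrib sum_distrib_left algebra_simps)
  then show ?thesis
    by (simp add: A_def)
qed

(* The rows are combined one at a time; at every stage the minor expands multilinearly into
   minors of f with weakly increasing row indices. *)
lemma tn_combine_adjacent_rows: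
  assumes f: "tn f" and \<alpha>: "\<And>i. 0 \<le> \<alpha> i" and \<beta>: "\<And>i. 0 \<le> \<beta> i"
  shows "tn (\<lambda>i j. \<alpha> i * f i j + \<beta> i * f (i - 1) j)"
  unfolding tn_def
proof (intro allI impI)
  fix k :: nat and I J :: "nat \<Rightarrow> nat"
  assume I: "mono_on {..<k} I" and J: "mono_on {..<k} J"
  define g where "g = (\<lambda>i j. \<alpha> i * f i j + \<beta> i * f (i - 1) j)"
  show "0 \<le> minor g k I J"
  proof (cases "inj_on I {..<k}")
    case False
    then obtain a b where "a < k" "b < k" "a \<noteq> b" "I a = I b"
      unfolding inj_on_def by auto
    then have "minor g k I J = 0"
      by (intro minor_equal_rows[of a k b]) auto
    then show ?thesis by simp
  next
    case True
    have less: "I a < I b" if "a < b" "b < k" for a b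
      using I True that unfolding mono_on_def inj_on_def
      by (metis lessThan_iff less_imp_le less_trans nat_neq_iff order_le_less)
    \<comment> \<open>Stage \<open>m\<close>: the first \<open>m\<close> rows are already combined,
      each later row is still a single row of \<open>f\<close> chosen by \<open>K\<close>.\<close>
    define D where "D m K = det (mat k k (\<lambda>(a, b). if a < m then g (I a) (J b) else f (K a) (J b)))"
      for m K
    have "0 \<le> D m K" if "m \<le> k" "\<And>a. a < k \<Longrightarrow> K a = I a \<or> K a = I a - 1" for m K
      using that
    proof (induction m arbitrary: K)
      case 0
      \<comment> \<open>For a < b, strictness of \<open>I\<close> gives K a \<le> I a \<le> I b - 1
        \<le> K b.\<close>
      have "mono_on {..<k} K"
      proof (rule mono_onI)
        fix a b assume "a \<in> {..<k}" "b \<in> {..<k}" "a \<le> b"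
        then show "K a \<le> K b"
          using 0(2)[of a] 0(2)[of b] less[of a b] by (cases "a = b") auto
      qed
      then have "0 \<le> minor f k K J"
        using f J unfolding tn_def by blast
      then show ?case by (simp add: D_def minor_def)
    next
      case (Suc m)
      let ?w = "\<lambda>a b. if a < m then g (I a) (J b) else f (K a) (J b)"
      have D_upd: "D m (K(m := i)) =
          det (mat k k (\<lambda>(a, b). if a = m then f i (J b) else ?w a b))" for i
        unfolding D_def by (intro arg_cong[where f = det] eq_matI) auto
      have "D (Suc m) K = det (mat k k (\<lambda>(a, b). if a = m
          then \<alpha> (I m) * f (I m) (J b) + \<beta> (I m) * f (I m - 1) (J b) else ?w a b))"
        unfolding D_def by (intro arg_cong[where f = det] eq_matI) (auto simp: g_def less_Suc_eq)
      also have "\<dots> = \<alpha> (I m) * D m (K(m := I m)) + \<beta> (I m) * D m (K(m := I m - 1))"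
        unfolding D_upd using Suc.prems by (intro det_row_combination) simp
      also have "\<dots> \<ge> 0"
        using Suc.prems \<alpha> \<beta> by (intro add_nonneg_nonneg mult_nonneg_nonneg Suc.IH) auto
      finally show ?case .
    qed
    from this[of k I] have "0 \<le> D k I"
      by simp
    also have "D k I = minor g k I J"
      unfolding D_def minor_def by (intro arg_cong[where f = det] eq_matI) auto
    finally show ?thesis .
  qed
qed

text \<open>The row version, transposed. At index 0 the truncated \<open>j - 1\<close> is again 0,
  so applications that want no term there set \<beta> to 0.\<close>

lemma tn_combine_adjacent_columns:
  assumes "tn f" "\<And>j. 0 \<le> \<alpha> j" "\<And>j. 0 \<le> \<beta> j"
  shows "tn (\<lambda>i j. \<alpha> j * f i j + \<beta> j * f i (j - 1))"
  using tn_transpose[OF tn_combine_adjacent_rows[OF tn_transpose[OF assms(1)] assms(2,3)]] .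

text \<open>The sums are formed in order of increasing row index: when row \<open>m\<close> is added
  to row \<open>Suc m\<close>, it already holds its own sum. Each addition is thus one combination
  of adjacent rows.\<close>

lemma tn_partial_row_sums:
  assumes f: "tn f"
    and outside: "\<And>i j. i \<le> t \<or> n < i \<Longrightarrow> g i j = f i j"
    and step: "\<And>i j. t \<le> i \<Longrightarrow> i < n \<Longrightarrow> g (Suc i) j = g i j + f (Suc i) j"
  shows "tn g"
proof (cases "t \<le> n")
  case False
  then have "g = f"
    using outside by (intro ext) (metis not_le_imp_less less_le_trans nat_le_linear)
  then show ?thesis using f by simp
next
  case True
  define h where "h m = (\<lambda>i j. if i \<le> m then g i j else f i j)" for m
  have "tn (h m)" if "t \<le> m" "m \<le> n" for m
    using that
  proof (induction m rule: dec_induct)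
    case base
    have "h t = f"
      using outside by (auto simp: h_def fun_eq_iff)
    then show ?case using f by simp
  next
    case (step m)
    have "h (Suc m) = (\<lambda>i j. 1 * h m i j + (if i = Suc m then 1 else 0) * h m (i - 1) j)"
      using assms(3)[of m] step by (auto simp: h_def fun_eq_iff le_Suc_eq)
    then show ?case
      using tn_combine_adjacent_rows[of "h m" "\<lambda>_. 1" "\<lambda>i. if i = Suc m then 1 else 0"] step
      by simp
  qed
  from this[of n] True have "tn (h n)" by simp
  moreover have "h n = g"
    using outside by (auto simp: h_def fun_eq_iff)
  ultimately show ?thesis by simp
qed

lemma tn_reindex_rows:
  assumes "tn f" "mono p"
  shows "tn (\<lambda>i. f (p i))"
  unfolding tn_def
proof (intro allI impI)
  fix k :: nat and I J :: "nat \<Rightarrow> nat"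
  assume "mono_on {..<k} I" "mono_on {..<k} J"
  moreover have "minor (\<lambda>i. f (p i)) k I J = minor f k (\<lambda>a. p (I a)) J"
    by (rule minor_cong) simp
  moreover have "mono_on {..<k} (\<lambda>a. p (I a))"
    using \<open>mono_on {..<k} I\<close> \<open>mono p\<close> by (auto simp: mono_on_def mono_def)
  ultimately show "0 \<le> minor (\<lambda>i. f (p i)) k I J"
    using \<open>tn f\<close> by (simp add: tn_def)
qed

section \<open>The identity array\<close>

text \<open>Row \<open>m\<close> vanishes: the columns before \<open>m\<close> carry the earlier
  values of \<open>I\<close>, which differ from \<open>I m\<close> by injectivity, and the columns
  from \<open>m\<close> on have indices at least \<open>J m > I m\<close>.\<close>

lemma minor_identity_zero:
  assumes I: "mono_on {..<k} I" and J: "mono_on {..<k} J" and inj: "inj_on I {..<k}"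
    and m: "m < k" "I m < J m" and eq: "\<And>a. a < m \<Longrightarrow> I a = J a"
  shows "minor (\<lambda>i j. if i = j then 1 else 0) k I J = 0"
proof (rule minor_zero_row[OF m(1)])
  fix b assume b: "b < k"
  have "I m \<noteq> J b"
  proof (cases "b < m")
    case True
    then show ?thesis
      using eq[OF True] inj m(1) b by (metis inj_onD lessThan_iff less_irrefl)
  next
    case False
    then have "J m \<le> J b"
      using J m b by (auto simp: mono_on_def)
    then show ?thesis using m by simp
  qed
  then show "(if I m = J b then 1 else 0) = (0 :: real)" by simp
qed

text \<open>A repeated index gives 0 and equal injective index maps give the unit matrix. Otherwise
  the first disagreement of \<open>I\<close> and \<open>J\<close> yields a zero row or, after
  transposing, a zero column.\<close>

lemma tn_identity: "tn (\<lambda>i j. if i = j then 1 else 0)"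
  (is "tn ?\<delta>")
  unfolding tn_def
proof (intro allI impI)
  fix k :: nat and I J :: "nat \<Rightarrow> nat"
  assume I: "mono_on {..<k} I" and J: "mono_on {..<k} J"
  have sym: "(\<lambda>i j. ?\<delta> j i) = ?\<delta>" by (intro ext) auto
  consider "\<not> inj_on I {..<k}" | "\<not> inj_on J {..<k}"
    | "inj_on I {..<k}" "inj_on J {..<k}" "\<forall>a<k. I a = J a"
    | m where "inj_on I {..<k}" "inj_on J {..<k}" "m < k" "I m \<noteq> J m" "\<forall>a<m. I a = J a"
  proof (cases "\<exists>m. m < k \<and> I m \<noteq> J m")
    case True
    then obtain m where "m < k" "I m \<noteq> J m" "\<forall>a<m. \<not> (a < k \<and> I a \<noteq> J a)"
      unfolding exists_least_iff[of "\<lambda>m. m < k \<and> I m \<noteq> J m"] by blast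
    then show ?thesis
      using that(1,2) that(4)[of m] by (meson less_trans)
  next
    case False
    then show ?thesis using that(1-3) by blast
  qed
  then show "0 \<le> minor ?\<delta> k I J"
  proof cases
    case 1
    then obtain a b where "a < k" "b < k" "a \<noteq> b" "I a = I b"
      unfolding inj_on_def by auto
    then show ?thesis
      by (subst minor_equal_rows[of a k b]) auto
  next
    case 2
    then obtain a b where "a < k" "b < k" "a \<noteq> b" "J a = J b"
      unfolding inj_on_def by auto
    then have "minor (\<lambda>i j. ?\<delta> j i) k J I = 0"
      by (subst minor_equal_rows[of a k b]) auto
    then show ?thesis
      unfolding minor_transpose[of ?\<delta>] by simp
  next
    case 3
    then have "mat k k (\<lambda>(a, b). ?\<delta> (I a) (J b)) = 1\<^sub>m k"
      by (intro eq_matI) (auto simp: inj_on_def)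
    then show ?thesis
      by (simp add: minor_def)
  next
    case (4 m)
    consider "I m < J m" | "J m < I m"
      using 4 by linarith
    then have "minor ?\<delta> k I J = 0"
    proof cases
      case 1
      then show ?thesis using minor_identity_zero[OF I J] 4 by auto
    next
      case 2
      then have "minor ?\<delta> k J I = 0"
        using 4 by (intro minor_identity_zero[OF J I]) auto
      then show ?thesis
        using minor_transpose[of ?\<delta> k J I] unfolding sym by simp
    qed
    then show ?thesis by simp
  qed
qed

section \<open>Return to matrices with both orders reversed\<close>

text \<open>Rows and columns undergo the same permutation, so its sign enters twice and
  cancels.\<close>

lemma minor_reverse:
  "minor f k (\<lambda>a. I (k - 1 - a)) (\<lambda>b. J (k - 1 - b)) = minor f k I J"
proof -
  \<comment> \<open>The reversal is its own inverse; it fixes everything from \<open>k\<close> on,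
    as \<open>permutes\<close> demands.\<close>
  define p where "p a = (if a < k then k - 1 - a else a)" for a
  have p: "p permutes {0..<k}"
    by (rule bij_imp_permutes, rule bij_betwI[where g = p]) (auto simp: p_def)
  have rows: "minor g k (\<lambda>a. I (k - 1 - a)) J = signof p * minor g k I J" for g I J
  proof -
    let ?A = "mat k k (\<lambda>(a, b). g (I a) (J b))"
    have "det (mat k k (\<lambda>(a, b). ?A $$ (p a, b))) = signof p * det ?A"
      by (rule det_permute_rows[OF _ p]) simp
    moreover have "mat k k (\<lambda>(a, b). ?A $$ (p a, b)) = mat k k (\<lambda>(a, b). g (I (k - 1 - a)) (J b))"
      by (rule eq_matI) (auto simp: p_def)
    ultimately show ?thesis by (simp add: minor_def)
  qed
  have "minor f k (\<lambda>a. I (k - 1 - a)) (\<lambda>b. J (k - 1 - b)) =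
      signof p * minor (\<lambda>i j. f j i) k (\<lambda>b. J (k - 1 - b)) I"
    unfolding minor_transpose[of f] by (rule rows)
  also have "\<dots> = signof p * signof p * minor f k I J"
    by (subst rows) (simp add: minor_transpose[of f])
  also have "signof p * signof p = (1 :: real)"
    by (auto simp: sign_def)
  finally show ?thesis by simp
qed

text \<open>The index maps \<open>r - pick I a\<close> and \<open>c - pick J b\<close> decrease
  weakly, even under truncation; reversing both makes them weakly increasing without changing the
  minor.\<close>

lemma tn_imp_totally_nonnegative:
  assumes f: "tn f"
    and A: "\<And>i j. i < dim_row A \<Longrightarrow> j < dim_col A \<Longrightarrow> A $$ (i, j) = f (r - i) (c - j)"
  shows "totally_nonnegative A"
  unfolding totally_nonnegative_def
proof (intro allI impI)
  fix k :: nat and I J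
  assume "1 \<le> k" and IJ: "I \<subseteq> {..<dim_row A}" "J \<subseteq> {..<dim_col A}" "card I = k" "card J = k"
  have eq: "{i. i < dim_row A \<and> i \<in> I} = I" "{j. j < dim_col A \<and> j \<in> J} = J"
    using IJ by auto
  have fin: "finite I" "finite J"
    using IJ by (auto intro: finite_subset)
  have in_set: "pick S a \<in> S" if "card S = k" "a < k" for S a
    using that pick_in_set_le[of a S] by simp
  have mono: "mono_on {..<k} (\<lambda>a. N - pick S (k - 1 - a))" if "card S = k" for N S
  proof (rule mono_onI)
    fix a b assume ab: "a \<in> {..<k}" "b \<in> {..<k}" "a \<le> b"
    have "pick S (k - 1 - b) \<le> pick S (k - 1 - a)"
    proof (cases "a = b")
      case False
      then show ?thesis
        using ab that pick_mono_le[of "k - 1 - a" S "k - 1 - b"] by force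
    qed simp
    then show "N - pick S (k - 1 - a) \<le> N - pick S (k - 1 - b)" by simp
  qed
  have "det (submatrix A I J) = minor f k (\<lambda>a. r - pick I a) (\<lambda>b. c - pick J b)"
    unfolding submatrix_def eq IJ(3,4) minor_def
    by (intro arg_cong[where f = det] eq_matI)
       (use IJ in_set in \<open>auto intro!: A\<close>)
  also have "\<dots> = minor f k (\<lambda>a. r - pick I (k - 1 - a)) (\<lambda>b. c - pick J (k - 1 - b))"
    by (rule minor_reverse[symmetric])
  also have "\<dots> \<ge> 0"
    using f mono IJ unfolding tn_def by blast
  finally show "0 \<le> det (submatrix A I J)" .
qed

section \<open>Coefficient arrays of polynomials\<close>

text \<open>Multiplication by a linear polynomial adds to each coefficient column a multiple of the
  preceding one.\<close>

lemma tn_coeff_linear_mult: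
  fixes P :: "nat \<Rightarrow> real poly"
  assumes "tn (\<lambda>i. coeff (P i))" "0 \<le> a" "0 \<le> b"
  shows "tn (\<lambda>i. coeff ([:a, b:] * P i))"
proof -
  have "coeff ([:a, b:] * P i) j = a * coeff (P i) j + (if j = 0 then 0 else b) * coeff (P i) (j - 1)"
    for i j
    by (cases j) simp_all
  then have "(\<lambda>i. coeff ([:a, b:] * P i)) =
      (\<lambda>i j. a * coeff (P i) j + (if j = 0 then 0 else b) * coeff (P i) (j - 1))"
    by (intro ext)
  then show ?thesis
    by (simp only:) (rule tn_combine_adjacent_columns, use assms in auto)
qed

abbreviation X :: "real poly" where "X \<equiv> [:0, 1:]"
abbreviation S :: "real poly" where "S \<equiv> [:1, 1:]"

lemma S_minus_1: "S - 1 = X"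
  by (simp add: one_pCons)

lemma coeff_S_power: "coeff (S ^ m) l = real (m choose l)"
proof (induction m arbitrary: l)
  case 0
  show ?case by (cases l) simp_all
next
  case (Suc m)
  then show ?case by (cases l) simp_all
qed

lemma coeff_X_S_eq_0:
  assumes "l < a \<or> a + m < l"
  shows "coeff (X ^ a * S ^ m) l = 0"
proof -
  have "X ^ a * S ^ m = monom 1 a * S ^ m"
    by (simp add: monom_altdef)
  then show ?thesis
    using assms by (auto simp: coeff_monom_mult coeff_S_power)
qed

(* From exponent t to t + 1, the rows 0..t live in columns 0..2t and get multiplied by S,
   while the remaining rows live in columns beyond 2t + 1. So adding column l - 1 to column l
   for l <= 2t + 1 does both. *)
lemma tn_X_S_powers: "tn (\<lambda>k. coeff (X ^ (2 * k) * S ^ (t - k)))"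
proof (induction t)
  case 0
  \<comment> \<open>At t = 0 the exponent of \<open>S\<close> truncates to 0, leaving the
    even-numbered rows of the identity.\<close>
  have "mono (\<lambda>k :: nat. 2 * k)" by (simp add: mono_def)
  from tn_reindex_rows[OF tn_identity this]
  show ?case by (simp flip: monom_altdef[of 1, simplified] add: coeff_monom)
next
  case (Suc t)
  let ?Q = "\<lambda>t k. X ^ (2 * k) * S ^ (t - k)"
  let ?\<beta> = "\<lambda>l. if 1 \<le> l \<and> l \<le> 2 * t + 1 then 1 else 0 :: real"
  have "coeff (?Q (Suc t) k) l = 1 * coeff (?Q t k) l + ?\<beta> l * coeff (?Q t k) (l - 1)" for k l
  proof (cases "k \<le> t")
    case True
    then have "?Q (Suc t) k = S * ?Q t k"
      by (simp add: Suc_diff_le del: mult_pCons_left)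
    then have "coeff (?Q (Suc t) k) l =
        coeff (?Q t k) l + (if l = 0 then 0 else coeff (?Q t k) (l - 1))"
      by (cases l) simp_all
    moreover have "coeff (?Q t k) (l - 1) = 0" if "l > 2 * t + 1"
      by (rule coeff_X_S_eq_0) (use that True in auto)
    ultimately show ?thesis by auto
  next
    case False
    \<comment> \<open>For k > t both exponents of \<open>S\<close> truncate to 0.\<close>
    then have "?Q (Suc t) k = ?Q t k" by simp
    moreover have "coeff (?Q t k) (l - 1) = 0" if "1 \<le> l" "l \<le> 2 * t + 1"
      by (rule coeff_X_S_eq_0) (use that False in auto)
    ultimately show ?thesis by auto
  qed
  then show ?case
    using tn_combine_adjacent_columns[OF Suc.IH, of "\<lambda>_. 1" ?\<beta>] by simp
qed

section \<open>Geometric sums and the rows built from them\<close>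

text \<open>With z = (s - 1)^2 / s, \<open>even_sum s r\<close> and \<open>alt_sum s r\<close> are
  s^r h_r and s^r g_r, so no division occurs.\<close>

definition even_sum :: "'a :: comm_ring_1 \<Rightarrow> nat \<Rightarrow> 'a" where
  "even_sum s r = (\<Sum>j\<le>r. s ^ (2 * j))"

definition alt_sum :: "'a :: comm_ring_1 \<Rightarrow> nat \<Rightarrow> 'a" where
  "alt_sum s r = (\<Sum>j\<le>2 * r. (- s) ^ j)"

lemma even_sum_0 [simp]: "even_sum s 0 = 1"
  and even_sum_Suc: "even_sum s (Suc r) = even_sum s r + s ^ (2 * r + 2)"
  by (simp_all add: even_sum_def)

lemma alt_sum_0 [simp]: "alt_sum s 0 = 1"
  and alt_sum_Suc: "alt_sum s (Suc r) = alt_sum s r - s ^ (2 * r + 1) + s ^ (2 * r + 2)"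
  by (simp_all add: alt_sum_def)

text \<open>This is h_(r+1) = h_r + g_(r+1), multiplied by s^(r+1).\<close>

lemma even_sum_step: "even_sum s (Suc r) = s * even_sum s r + alt_sum s (Suc r)"
proof (induction r)
  case 0
  show ?case by (simp add: even_sum_Suc alt_sum_Suc)
next
  case (Suc r)
  have "even_sum s (Suc (Suc r)) = s * even_sum s r + alt_sum s (Suc r) + s ^ (2 * Suc r + 2)"
    by (subst even_sum_Suc, subst Suc) simp
  also have "\<dots> = s * even_sum s (Suc r) + alt_sum s (Suc (Suc r))"
    unfolding even_sum_Suc[of s r] alt_sum_Suc[of s "Suc r"] by (simp add: algebra_simps)
  finally show ?case .
qed

text \<open>This is g_(r+1) = g_r + z h_r, multiplied by s^(r+1).\<close>

lemma alt_sum_step: "alt_sum s (Suc r) = s * alt_sum s r + (s - 1) ^ 2 * even_sum s r"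
proof (induction r)
  case 0
  show ?case by (simp add: alt_sum_Suc power2_eq_square algebra_simps)
next
  case (Suc r)
  have "alt_sum s (Suc (Suc r)) =
      s * alt_sum s r + (s - 1) ^ 2 * even_sum s r - s ^ (2 * Suc r + 1) + s ^ (2 * Suc r + 2)"
    by (subst alt_sum_Suc, subst Suc) simp
  also have "\<dots> = s * alt_sum s (Suc r) + (s - 1) ^ 2 * even_sum s (Suc r)"
    unfolding alt_sum_Suc[of s r] even_sum_Suc[of s r] by (simp add: algebra_simps power2_eq_square)
  finally show ?case .
qed

lemma even_sum_closed: "(s ^ 2 - 1) * even_sum s r = s ^ (2 * r + 2) - 1"
  by (induction r) (simp_all add: even_sum_Suc algebra_simps power2_eq_square)

text \<open>The even and odd exponents interleave to the full geometric sum over 0..2r+2.\<close>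

lemma even_sum_adjacent_closed:
  "(s - 1) * (even_sum s (Suc r) + s * even_sum s r) = s ^ (2 * r + 3) - 1"
  by (induction r) (simp_all add: even_sum_Suc algebra_simps power2_eq_square numeral_3_eq_3)

(* In terms of z = X^2 / S, these rows are S^n z^t times the coefficient polynomials
   sum_k C(r+k, 2k) z^k and sum_k C(r+k+1, 2k+1) z^k, where r = i - t; rows outside t..n are S^n z^i. *)
definition alt_row :: "nat \<Rightarrow> nat \<Rightarrow> nat \<Rightarrow> real poly" where
  "alt_row n t i = (if t \<le> i \<and> i \<le> n then X ^ (2 * t) * S ^ (n - i) * alt_sum S (i - t)
     else X ^ (2 * i) * S ^ (n - i))"

definition even_row :: "nat \<Rightarrow> nat \<Rightarrow> nat \<Rightarrow> real poly" where
  "even_row n t i = (if t \<le> i \<and> i \<le> n then X ^ (2 * t) * S ^ (n - i) * even_sum S (i - t)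
     else X ^ (2 * i) * S ^ (n - i))"

lemma even_row_Suc:
  assumes "t \<le> i" "i < n"
  shows "even_row n t (Suc i) = even_row n t i + alt_row n t (Suc i)"
proof -
  have "n - i = Suc (n - Suc i)" "Suc i - t = Suc (i - t)"
    using assms by auto
  then show ?thesis
    using assms unfolding even_row_def alt_row_def
    by (simp add: even_sum_step algebra_simps del: mult_pCons_left mult_pCons_right)
qed

text \<open>In \<open>alt_sum_step\<close> the factor (S - 1)^2 = X^2 raises X^(2t) to X^(2(t+1)),
  which turns the second term into an even row for \<open>Suc t\<close>.\<close>

lemma alt_row_Suc:
  assumes "t \<le> i" "i < n"
  shows "alt_row n t (Suc i) = alt_row n t i + even_row n (Suc t) (Suc i)"
proof -
  have "n - i = Suc (n - Suc i)" "Suc i - t = Suc (i - t)"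
    using assms by auto
  then show ?thesis
    using assms unfolding even_row_def alt_row_def
    by (simp add: alt_sum_step S_minus_1 power2_eq_square algebra_simps del: mult_pCons_left mult_pCons_right)
qed

text \<open>Descending induction from t = n, where both families are X^(2i) S^(n-i). Partial sums of
  the even rows for \<open>Suc t\<close> give the alternating rows for \<open>t\<close>, whose
  partial sums give the even rows for \<open>t\<close>.\<close>

lemma tn_alt_row_even_row: "t \<le> n \<Longrightarrow> tn (\<lambda>i. coeff (alt_row n t i)) \<and> tn (\<lambda>i. coeff (even_row n t i))"
proof (induction t rule: inc_induct)
  case base
  have "alt_row n n = (\<lambda>k. X ^ (2 * k) * S ^ (n - k))" "even_row n n = (\<lambda>k. X ^ (2 * k) * S ^ (n - k))"
    by (auto simp: alt_row_def even_row_def fun_eq_iff)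
  then show ?case
    using tn_X_S_powers[of n] by simp
next
  case (step t)
  have alt: "tn (\<lambda>i. coeff (alt_row n t i))"
  proof (rule tn_partial_row_sums[of "\<lambda>i. coeff (even_row n (Suc t) i)" t n])
    \<comment> \<open>Row \<open>t\<close> starts the summation: \<open>alt_sum S 0\<close> is 1,
      and for \<open>Suc t\<close> this row lies before the modified range.\<close>
    show "coeff (alt_row n t i) j = coeff (even_row n (Suc t) i) j" if "i \<le> t \<or> n < i" for i j
      using that by (cases "i = t") (auto simp: alt_row_def even_row_def)
  qed (use step alt_row_Suc in auto)
  moreover have "tn (\<lambda>i. coeff (even_row n t i))"
  proof (rule tn_partial_row_sums[OF alt, of t n])
    show "coeff (even_row n t i) j = coeff (alt_row n t i) j" if "i \<le> t \<or> n < i" for i j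
      using that by (cases "i = t") (auto simp: alt_row_def even_row_def)
  qed (use even_row_Suc in auto)
  ultimately show ?case by simp
qed

section \<open>The matrices for odd and even d\<close>

text \<open>The linear factors X and X + 2 have product S^2 - 1, which closes the even sum to
  S^(2r+2) - 1 with r = n - i; the remaining S^i gives the required difference of powers.\<close>

lemma totally_nonnegative_M_odd: "totally_nonnegative (M (2 * n + 1))"
proof (rule tn_imp_totally_nonnegative)
  show "tn (\<lambda>i. coeff ([:0, 1:] * ([:2, 1:] * even_row n 0 i)))"
    using tn_alt_row_even_row[of 0 n] by (intro tn_coeff_linear_mult) auto
next
  fix i j
  assume ij: "i < dim_row (M (2 * n + 1))" "j < dim_col (M (2 * n + 1))"
  then have i: "i \<le> n" and j: "j < 2 * n + 1"
    by (auto simp: M_def)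
  have "[:0, 1:] * ([:2, 1:] * even_row n 0 (n - i)) = S ^ i * ((S ^ 2 - 1) * even_sum S (n - i))"
  proof -
    have "[:0, 1:] * [:2, 1:] = S ^ 2 - 1"
      by (simp add: power2_eq_square one_pCons)
    then have "[:0, 1:] * ([:2, 1:] * p) = (S ^ 2 - 1) * p" for p
      by (simp only: flip: mult.assoc)
    moreover have "even_row n 0 (n - i) = S ^ i * even_sum S (n - i)"
      using i by (simp add: even_row_def)
    ultimately show ?thesis
      by (simp only: mult.left_commute)
  qed
  also have "\<dots> = S ^ (i + (2 * (n - i) + 2)) - S ^ i"
    unfolding even_sum_closed by (simp add: algebra_simps power_add del: mult_pCons_left mult_pCons_right)
  also have "i + (2 * (n - i) + 2) = 2 * n + 1 + 1 - i"
    using i by simp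
  finally have "coeff ([:0, 1:] * ([:2, 1:] * even_row n 0 (n - i))) (2 * n + 1 - j) =
      real ((2 * n + 1 + 1 - i) choose (2 * n + 1 - j)) - real (i choose (2 * n + 1 - j))"
    by (simp only: coeff_diff coeff_S_power)
  then show "M (2 * n + 1) $$ (i, j) =
      coeff ([:0, 1:] * ([:2, 1:] * even_row n 0 (n - i))) (2 * n + 1 - j)"
    using i j by (simp add: M_def)
qed

lemma totally_nonnegative_M_even: "totally_nonnegative (M (2 * n))"
proof (rule tn_imp_totally_nonnegative)
  \<comment> \<open>This is h_r + h_(r-1) with h_(-1) = 0; the case distinction avoids the truncated
    \<open>0 - 1\<close>.\<close>
  define P where "P i = even_row n 0 i + (if i = 0 then 0 else even_row n 0 (i - 1))" for i
  have "tn (\<lambda>i. coeff (even_row n 0 i))"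
    using tn_alt_row_even_row[of 0 n] by simp
  from tn_combine_adjacent_rows[OF this, of "\<lambda>_. 1" "\<lambda>i. if i = 0 then 0 else 1"]
  have "tn (\<lambda>i j. coeff (even_row n 0 i) j + (if i = 0 then 0 else 1) * coeff (even_row n 0 (i - 1)) j)"
    by simp
  also have "(\<lambda>i j. coeff (even_row n 0 i) j + (if i = 0 then 0 else 1) * coeff (even_row n 0 (i - 1)) j)
      = (\<lambda>i. coeff (P i))"
    by (auto simp: P_def fun_eq_iff)
  finally show "tn (\<lambda>i. coeff ([:0, 1:] * P i))"
    by (intro tn_coeff_linear_mult) auto
  fix i j
  assume ij: "i < dim_row (M (2 * n))" "j < dim_col (M (2 * n))"
  then have i: "i \<le> n" and j: "j < 2 * n"
    by (auto simp: M_def)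
  have "X * P (n - i) = S ^ (2 * n + 1 - i) - S ^ i"
  proof (cases "n - i")
    case 0
    then have "i = n" using i by simp
    have "X * P (n - i) = S ^ n * X"
      using \<open>i = n\<close> by (simp add: P_def even_row_def)
    also have "\<dots> = S ^ (n + 1) - S ^ n"
      unfolding S_minus_1[symmetric] by (simp add: algebra_simps del: mult_pCons_left mult_pCons_right)
    finally show ?thesis using \<open>i = n\<close> by simp
  next
    case (Suc r)
    \<comment> \<open>The preceding row carries S^(i+1), whence the extra factor S before
      \<open>even_sum S r\<close>.\<close>
    then have "n - r = Suc i" "n = Suc r + i"
      using i by auto
    then have "X * P (n - i) = S ^ i * ((S - 1) * (even_sum S (Suc r) + S * even_sum S r))"
      unfolding S_minus_1 P_def Suc even_row_def
      by (simp add: algebra_simps del: mult_pCons_left mult_pCons_right)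
    also have "\<dots> = S ^ (i + (2 * r + 3)) - S ^ i"
      unfolding even_sum_adjacent_closed by (simp add: algebra_simps power_add del: mult_pCons_left mult_pCons_right)
    also have "i + (2 * r + 3) = 2 * n + 1 - i"
      using \<open>n = Suc r + i\<close> by simp
    finally show ?thesis .
  qed
  then have "coeff (X * P (n - i)) (2 * n - j) =
      real ((2 * n + 1 - i) choose (2 * n - j)) - real (i choose (2 * n - j))"
    by (simp only: coeff_diff coeff_S_power)
  then show "M (2 * n) $$ (i, j) = coeff ([:0, 1:] * P (n - i)) (2 * n - j)"
    using i j by (simp add: M_def)
qed

theorem theorem2p1:
  fixes d :: nat
  assumes "d \<ge> 1"
  shows "totally_nonnegative (M d)"
  using totally_nonnegative_M_even totally_nonnegative_M_odd by (cases "even d") (auto elim!: evenE oddE)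

end
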